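(* Let $K\ge 1$ and consider the binary-symmetric parallel-relay (BSPR) network with $K$ relays and cross-over probabilities $p_{s,i},p_{i,d}\in[0,\tfrac12]$, $i=1,\dots,K$. For every achievable rate $R$ of this network there exists a product distribution $p(u)p(x_1)\cdots p(x_K)$ of the inputs $U,X_1,\dots,X_K\in\{0,1\}$ such that $$R\le \min\Big\{ I(U;V_1,V_2,\dots,V_K),\ \sum_{i=1}^K I(X_i;Y_i)\Big\},$$ where $V_i=U\oplus Z_i$ and $Y_i=X_i\oplus E_i$, with $Z_1,\dots,Z_K,E_1,\dots,E_K$ mutually independent binary variables, independent of $(U,X_1,\dots,X_K)$, with $\Pr\{Z_i=1\}=p_{s,i}$ and $\Pr\{E_i=1\}=p_{i,d}$.
   Context: **The BSPR network.** There is one source, $K$ relays $1,\dots,K$, and one destination. All channel inputs, outputs and noises are binary, and $\oplus$ is addition modulo 2. At each time $t=1,2,\dots$ the source transmits $U[t]\in\{0,1\}$ and relay $i$ receives $V_i[t]=U[t]\oplus Z_i[t]$ with $\Pr\{Z_i[t]=1\}=p_{s,i}$; relay $i$ transmits $X_i[t]\in\{0,1\}$ and the destination receives, on a separate link for each $i$, $Y_i[t]=X_i[t]\oplus E_i[t]$ with $\Pr\{E_i[t]=1\}=p_{i,d}$. Here $0\le p_{s,i},p_{i,d}\le \tfrac12$. All the noises $Z_i[t],E_i[t]$ (over all $i,t$) are independent of each other and of the message. **Codes and achievable rates.** A code of rate $R\ge 0$ and length $n$ has a message $W$ uniform on $\{0,1,\dots,\lceil 2^{nR}\rceil-1\}$,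 a source encoder giving $(U[1],\dots,U[n])$ as a function of $W$, for each relay $i$ and time $t\le n$ a function giving $X_i[t]$ from $(V_i[1],\dots,V_i[t-1])$, and a decoder giving $\hat W$ from $(Y_i[t])_{1\le i\le K,\,1\le t\le n}$. Its error probability is $P_e=\Pr\{\hat W\ne W\}$. A rate $R$ is achievable if for every $\epsilon>0$ and all sufficiently large $n$ there is a code of rate $R$ and length $n$ with $P_e<\epsilon$. $I(\cdot\,;\cdot)$ is mutual information with logarithms to base 2; rates are in bits per channel use. *)

theory Defs
  imports "HOL-Probability.Probability"
begin

text \<open>
  Binary symbols are booleans (\<open>True\<close> is 1, \<open>False\<close> is 0), so that addition modulo 2 is
  \<open>(\<noteq>)\<close>. Relays are numbered \<open>1..K\<close> and times \<open>1..n\<close>; the functions \<open>ps\<close> and \<open>pd\<close> give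
  the cross-over probabilities of the source-relay and the relay-destination links.
\<close>

text \<open>
  Strict causality is built into the list arguments: at time \<open>t\<close> relay \<open>i\<close> applies
  \<open>relay_enc c i t\<close> to \<open>[V_i[1], ..., V_i[t-1]]\<close>. The decoder sees the list, over the
  relays, of the received words \<open>[Y_i[1], ..., Y_i[n]]\<close>.
\<close>

record bspr_code =
  source_enc :: "nat \<Rightarrow> nat \<Rightarrow> bool"  \<comment> \<open>message, time\<close>
  relay_enc :: "nat \<Rightarrow> nat \<Rightarrow> bool list \<Rightarrow> bool"  \<comment> \<open>relay, time, past received symbols\<close>
  decoder :: "bool list list \<Rightarrow> nat"

definition num_messages :: "nat \<Rightarrow> real \<Rightarrow> nat" where
  "num_messages n R = nat \<lceil>2 powr (real n * R)\<rceil>"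

definition relay_received :: "bspr_code \<Rightarrow> nat \<Rightarrow> (nat \<times> nat \<Rightarrow> bool) \<Rightarrow> nat \<Rightarrow> nat \<Rightarrow> bool" where
  "relay_received c w z i t = (source_enc c w t \<noteq> z (i, t))"

definition relay_sent :: "bspr_code \<Rightarrow> nat \<Rightarrow> (nat \<times> nat \<Rightarrow> bool) \<Rightarrow> nat \<Rightarrow> nat \<Rightarrow> bool" where
  "relay_sent c w z i t = relay_enc c i t (map (relay_received c w z i) [1..<t])"

definition dest_received ::
  "bspr_code \<Rightarrow> nat \<Rightarrow> (nat \<times> nat \<Rightarrow> bool) \<Rightarrow> (nat \<times> nat \<Rightarrow> bool) \<Rightarrow> nat \<Rightarrow> nat \<Rightarrow> bool" where
  "dest_received c w z e i t = (relay_sent c w z i t \<noteq> e (i, t))"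

definition decoded ::
  "nat \<Rightarrow> nat \<Rightarrow> bspr_code \<Rightarrow> nat \<Rightarrow> (nat \<times> nat \<Rightarrow> bool) \<Rightarrow> (nat \<times> nat \<Rightarrow> bool) \<Rightarrow> nat" where
  "decoded K n c w z e =
     decoder c (map (\<lambda>i. map (dest_received c w z e i) [1..<Suc n]) [1..<Suc K])"

definition block_noise :: "nat \<Rightarrow> nat \<Rightarrow> (nat \<Rightarrow> real) \<Rightarrow> (nat \<times> nat \<Rightarrow> bool) pmf" where
  "block_noise K n p = Pi_pmf ({1..K} \<times> {1..n}) False (\<lambda>(i, t). bernoulli_pmf (p i))"

definition error_prob ::
  "nat \<Rightarrow> (nat \<Rightarrow> real) \<Rightarrow> (nat \<Rightarrow> real) \<Rightarrow> real \<Rightarrow> nat \<Rightarrow> bspr_code \<Rightarrow> real" where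
  "error_prob K ps pd R n c =
     measure_pmf.prob
       (pair_pmf (pmf_of_set {0..<num_messages n R})
          (pair_pmf (block_noise K n ps) (block_noise K n pd)))
       {(w, z, e). decoded K n c w z e \<noteq> w}"

definition achievable :: "nat \<Rightarrow> (nat \<Rightarrow> real) \<Rightarrow> (nat \<Rightarrow> real) \<Rightarrow> real \<Rightarrow> bool" where
  "achievable K ps pd R \<longleftrightarrow>
     0 \<le> R \<and> (\<forall>\<epsilon>>0. \<exists>N. \<forall>n\<ge>N. \<exists>c. error_prob K ps pd R n c < \<epsilon>)"

text \<open>
  Joint distribution of \<open>(U, (X_i), (Z_i), (E_i))\<close>: independent inputs with laws \<open>pu\<close> and
  \<open>px i\<close>, and independent noises.
\<close>

definition single_letter ::
  "nat \<Rightarrow> (nat \<Rightarrow> real) \<Rightarrow> (nat \<Rightarrow> real) \<Rightarrow> bool pmf \<Rightarrow> (nat \<Rightarrow> bool pmf) \<Rightarrow>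
     (bool \<times> (nat \<Rightarrow> bool) \<times> (nat \<Rightarrow> bool) \<times> (nat \<Rightarrow> bool)) pmf" where
  "single_letter K ps pd pu px =
     pair_pmf pu
       (pair_pmf (Pi_pmf {1..K} False px)
         (pair_pmf (Pi_pmf {1..K} False (\<lambda>i. bernoulli_pmf (ps i)))
                   (Pi_pmf {1..K} False (\<lambda>i. bernoulli_pmf (pd i)))))"

text \<open>
  Mutual information in bits of two finitely valued random variables; this is the instance
  abbreviated \<open>\<I>(X ; Y)\<close> inside the locale \<open>information_space\<close>.
\<close>

definition mutual_info :: "'a pmf \<Rightarrow> ('a \<Rightarrow> 'b) \<Rightarrow> ('a \<Rightarrow> 'c) \<Rightarrow> real" where
  "mutual_info p X Y =
     prob_space.mutual_information (measure_pmf p) 2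
       (count_space (range X)) (count_space (range Y)) X Y"

end

theory Submission
  imports Defs
begin

text \<open>
  Both links are symmetric, so uniform inputs serve both terms of the minimum: under the output law
  \<open>Q\<close> of the uniform input, every conditional output law has the same divergence from \<open>Q\<close>, and
  this divergence is the single-letter mutual information. Fix the noise on one side of the relays.
  What remains is a guessing problem: \<open>w\<close> is guessed from an observation \<open>y\<close> distributed as a product
  \<open>P w\<close> (independent coordinates, given \<open>w\<close> and the fixed noise). If \<open>y\<close> had the product law
  built from \<open>Q\<close>, which does not depend on \<open>w\<close>, the guess would be right with probability at
  most \<open>1 / M\<close>; changing measure shows that (success probability) \<open>* log M \<le> n * C + 1\<close>.
\<close>

section \<open>Relative entropy and product distributions\<close>

text \<open>Relative entropy in bits. Since division by zero yields 0, the value is the usual one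
  only when the support of \<open>P\<close> lies in that of \<open>Q\<close>; this is why support
  inclusions accompany its use below.\<close>

definition kl :: "'a pmf \<Rightarrow> 'a pmf \<Rightarrow> real" where
  "kl P Q = measure_pmf.expectation P (\<lambda>y. log 2 (pmf P y / pmf Q y))"

lemma kl_eq_sum:
  assumes "finite B" "set_pmf P \<subseteq> B"
  shows "kl P Q = (\<Sum>y\<in>B. pmf P y * log 2 (pmf P y / pmf Q y))"
  unfolding kl_def using assms
  by (subst integral_measure_pmf[of B]) auto

lemma kl_map_pmf_inj:
  assumes "inj f"
  shows "kl (map_pmf f P) (map_pmf f Q) = kl P Q"
  unfolding kl_def by (simp add: pmf_map_inj'[OF assms])

text \<open>On the support the likelihood ratio of two products is a product of positive coordinate
  ratios, so its logarithm is a sum, and the expectation of each summand depends on one marginal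
  only. Finite supports give integrability.\<close>

lemma kl_Pi_pmf:
  assumes A: "finite A"
    and fin: "\<And>x. x \<in> A \<Longrightarrow> finite (set_pmf (P x))"
    and ac: "\<And>x. x \<in> A \<Longrightarrow> set_pmf (P x) \<subseteq> set_pmf (Q x)"
  shows "kl (Pi_pmf A d P) (Pi_pmf A d Q) = (\<Sum>x\<in>A. kl (P x) (Q x))"
proof -
  let ?\<PP> = "Pi_pmf A d P"
  let ?l = "\<lambda>x y. log 2 (pmf (P x) y / pmf (Q x) y)"
  have fin': "finite (set_pmf ?\<PP>)"
    using A fin by (simp add: set_Pi_pmf finite_PiE_dflt)
  have "kl ?\<PP> (Pi_pmf A d Q) = measure_pmf.expectation ?\<PP> (\<lambda>f. \<Sum>x\<in>A. ?l x (f x))"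
    unfolding kl_def
  proof (rule integral_cong_AE)
    show "AE f in measure_pmf ?\<PP>.
      log 2 (pmf ?\<PP> f / pmf (Pi_pmf A d Q) f) = (\<Sum>x\<in>A. ?l x (f x))"
    proof (rule AE_pmfI)
      fix f assume "f \<in> set_pmf ?\<PP>"
      then have f: "f \<in> PiE_dflt A d (set_pmf \<circ> P)"
        using A by (simp add: set_Pi_pmf)
      then have mem: "f x \<in> set_pmf (P x)" "f x \<in> set_pmf (Q x)" if "x \<in> A" for x
        using that ac by (auto simp: PiE_dflt_def)
      then have pos: "pmf (P x) (f x) / pmf (Q x) (f x) > 0" if "x \<in> A" for x
        using that by (simp add: pmf_positive)
      have "pmf ?\<PP> f / pmf (Pi_pmf A d Q) f = (\<Prod>x\<in>A. pmf (P x) (f x) / pmf (Q x) (f x))"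
        using A f by (subst (1 2) pmf_Pi') (auto simp: PiE_dflt_def prod_dividef)
      then show "log 2 (pmf ?\<PP> f / pmf (Pi_pmf A d Q) f) = (\<Sum>x\<in>A. ?l x (f x))"
        using pos by (simp add: log_def ln_prod[OF A less_imp_neq[symmetric]] sum_divide_distrib
            del: divide_eq_0_iff times_divide_eq_left)
    qed
  qed simp_all
  also have "\<dots> = (\<Sum>x\<in>A. measure_pmf.expectation ?\<PP> (\<lambda>f. ?l x (f x)))"
    by (rule Bochner_Integration.integral_sum) (simp add: integrable_measure_pmf_finite fin')
  also have "\<dots> = (\<Sum>x\<in>A. kl (P x) (Q x))"
  proof (rule sum.cong)
    fix x assume "x \<in> A"
    then have "kl (P x) (Q x) = measure_pmf.expectation (map_pmf (\<lambda>f. f x) ?\<PP>) (?l x)"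
      using A by (simp add: kl_def Pi_pmf_component)
    then show "measure_pmf.expectation ?\<PP> (\<lambda>f. ?l x (f x)) = kl (P x) (Q x)"
      by simp
  qed simp
  finally show ?thesis .
qed

text \<open>The map may vary with the coordinate and need not send \<open>d\<close> to
  \<open>d'\<close>, hence the explicit reset outside \<open>A\<close>.\<close>

lemma Pi_pmf_map_dependent:
  assumes "finite A"
  shows "Pi_pmf A d' (\<lambda>x. map_pmf (f x) (g x)) =
    map_pmf (\<lambda>h x. if x \<in> A then f x (h x) else d') (Pi_pmf A d g)"
  unfolding map_pmf_def
  using assms by (subst Pi_pmf_bind[where d' = d]) simp_all

text \<open>Groups an independent family by its second index. It serves to read the noise on
  relay-time pairs as independent noise vectors, one per time.\<close>

lemma Pi_pmf_Times:
  assumes A: "finite A" and B: "finite B"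
  shows "Pi_pmf (A \<times> B) d p =
    map_pmf (\<lambda>g (x, y). g y x) (Pi_pmf B (\<lambda>_. d) (\<lambda>y. Pi_pmf A d (\<lambda>x. p (x, y))))"
proof (rule pmf_eqI)
  fix f :: "'a \<times> 'b \<Rightarrow> 'c"
  define h where "h = (\<lambda>y x. f (x, y))"
  have f: "f = (\<lambda>(x, y). h y x)" by (auto simp: h_def)
  have inj: "inj (\<lambda>g (x :: 'a, y :: 'b). g y x :: 'c)"
    by (rule injI) (simp add: fun_eq_iff)
  have "pmf (Pi_pmf (A \<times> B) d p) f = 
    pmf (Pi_pmf B (\<lambda>_. d) (\<lambda>y. Pi_pmf A d (\<lambda>x. p (x, y)))) h"
  \<comment> \<open>Either both masses are the same double product, or \<open>f\<close> departs from
    the default outside the rectangle and both are 0.\<close>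
  proof (cases "\<forall>z. z \<notin> A \<times> B \<longrightarrow> f z = d")
    case True
    then have "pmf (Pi_pmf (A \<times> B) d p) f = (\<Prod>z\<in>A \<times> B. pmf (p z) (f z))"
      using A B by (subst pmf_Pi') auto
    also have "\<dots> = (\<Prod>y\<in>B. \<Prod>x\<in>A. pmf (p (x, y)) (f (x, y)))"
      by (subst prod.swap) (simp add: prod.cartesian_product case_prod_unfold)
    also have "\<dots> = pmf (Pi_pmf B (\<lambda>_. d) (\<lambda>y. Pi_pmf A d (\<lambda>x. p (x, y)))) h"
      using A B True by (subst pmf_Pi') (auto simp: h_def pmf_Pi intro!: prod.cong)
    finally show ?thesis .
  next
    case False
    then obtain x y where xy: "(x, y) \<notin> A \<times> B" "h y x \<noteq> d"
      by (auto simp: h_def)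
    have "pmf (Pi_pmf B (\<lambda>_. d) (\<lambda>y. Pi_pmf A d (\<lambda>x. p (x, y)))) h = 0"
    proof (cases "y \<in> B")
      case True
      then have "pmf (Pi_pmf A d (\<lambda>x. p (x, y))) (h y) = 0"
        using A xy by (intro pmf_Pi_outside) auto
      then show ?thesis using B True by (auto simp: pmf_Pi)
    next
      case False
      then show ?thesis using B xy by (intro pmf_Pi_outside) auto
    qed
    moreover have "pmf (Pi_pmf (A \<times> B) d p) f = 0"
      using A B False by (intro pmf_Pi_outside) auto
    ultimately show ?thesis by simp
  qed
  also have "\<dots> = pmf (map_pmf (\<lambda>g (x, y). g y x)
      (Pi_pmf B (\<lambda>_. d) (\<lambda>y. Pi_pmf A d (\<lambda>x. p (x, y))))) f"
    unfolding f by (rule pmf_map_inj'[OF inj, symmetric])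
  finally show "pmf (Pi_pmf (A \<times> B) d p) f = pmf (map_pmf (\<lambda>g (x, y). g y x)
      (Pi_pmf B (\<lambda>_. d) (\<lambda>y. Pi_pmf A d (\<lambda>x. p (x, y))))) f" .
qed

section \<open>Change of measure and the guessing bound\<close>

lemma prob_bind_pmf:
  "measure_pmf.prob (bind_pmf A f) S = measure_pmf.expectation A (\<lambda>x. measure_pmf.prob (f x) S)"
proof -
  have *: "measure_pmf.prob M S = pmf (map_pmf (\<lambda>x. x \<in> S) M) True" for M
    by (simp add: pmf_map vimage_def)
  show ?thesis by (simp add: * map_bind_pmf pmf_bind)
qed

text \<open>Averaging step that allows the noise of one hop to be fixed: the bound is linear in the
  probability, so it survives the expectation over \<open>x\<close>.\<close>

lemma prob_bind_pmf_mult_le: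
  fixes L c :: real
  assumes "\<And>x. x \<in> set_pmf A \<Longrightarrow> measure_pmf.prob (f x) S * L \<le> c"
  shows "measure_pmf.prob (bind_pmf A f) S * L \<le> c"
proof -
  have int: "integrable (measure_pmf A) (\<lambda>x. measure_pmf.prob (f x) S)"
    by (rule measure_pmf.integrable_const_bound[where B = 1]) auto
  have "measure_pmf.prob (bind_pmf A f) S * L =
      measure_pmf.expectation A (\<lambda>x. measure_pmf.prob (f x) S * L)"
    using int by (simp add: prob_bind_pmf)
  also have "\<dots> \<le> c"
    using int assms by (intro measure_pmf.integral_le_const) (auto simp: AE_measure_pmf_iff)
  finally show ?thesis .
qed

text \<open>
  The Donsker--Varadhan bound with test function \<open>g = m ^ indicator S\<close>, proved from
  \<open>ln x \<le> x - 1\<close>. With \<open>m = M\<close> the correction term becomes nonpositive after summation over the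
  \<open>M\<close> disjoint decision regions.
\<close>

lemma kl_change_of_measure:
  fixes m :: real
  assumes fin: "finite (set_pmf P)" and ac: "set_pmf P \<subseteq> set_pmf Q" and m: "m > 0"
  shows "measure_pmf.prob P S * log 2 m \<le>
    kl P Q + 1 + (((m - 1) * measure_pmf.prob Q S + 1) / 2 - 1) / ln 2"
proof -
  let ?F = "set_pmf P"
  define g where "g = (\<lambda>y. if y \<in> S then m else (1::real))"
  have gpos: "g y > 0" for y using m by (simp add: g_def)
  \<comment> \<open>The term \<open>ln 2\<close> becomes the factor 2 dividing \<open>g\<close>; it
    costs the one extra bit of the bound and absorbs the \<open>Q\<close>-mean of \<open>g\<close>,
    which is below 2 on average over disjoint regions when \<open>m = M\<close>.\<close>
  have pt: "pmf P y * (indicator S y * ln m - ln (pmf P y / pmf Q y) - ln 2)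
      \<le> pmf Q y * g y / 2 - pmf P y" if "y \<in> ?F" for y
  proof -
    have p: "pmf P y > 0" and q: "pmf Q y > 0" using that ac by (auto intro: pmf_positive)
    have "indicator S y * ln m - ln (pmf P y / pmf Q y) - ln 2 = ln (g y * pmf Q y / (2 * pmf P y))"
      using p q m by (auto simp: g_def ln_div ln_mult indicator_def)
    also have "\<dots> \<le> g y * pmf Q y / (2 * pmf P y) - 1"
      using p q gpos[of y] by (intro ln_le_minus_one) simp
    finally have "pmf P y * (indicator S y * ln m - ln (pmf P y / pmf Q y) - ln 2)
      \<le> pmf P y * (g y * pmf Q y / (2 * pmf P y) - 1)"
      using p by (intro mult_left_mono) auto
    also have "\<dots> = pmf Q y * g y / 2 - pmf P y"
      using p by (simp add: field_simps)
    finally show ?thesis .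
  qed
  have P1: "(\<Sum>y\<in>?F. pmf P y) = 1"
    using fin by (simp add: sum_pmf_eq_1)
  have PS: "(\<Sum>y\<in>?F. pmf P y * indicator S y) = measure_pmf.prob P S"
  proof -
    have "measure_pmf.prob P S = measure_pmf.expectation P (indicator S)" by simp
    also have "\<dots> = (\<Sum>y\<in>?F. pmf P y * indicator S y)"
      using fin by (subst integral_measure_pmf[of ?F]) auto
    finally show ?thesis by simp
  qed
  have kl: "(\<Sum>y\<in>?F. pmf P y * ln (pmf P y / pmf Q y)) = kl P Q * ln 2"
    using fin by (simp add: kl_eq_sum[of ?F] sum_distrib_right log_def)
  \<comment> \<open>Extending the sum from the support of \<open>P\<close> to all of
    \<open>Q\<close> only adds nonnegative terms, and \<open>g\<close> equals
    \<open>(m - 1) * indicator S + 1\<close>.\<close>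
  have Qg: "(\<Sum>y\<in>?F. pmf Q y * g y) \<le> (m - 1) * measure_pmf.prob Q S + 1"
  proof -
    have "(\<Sum>y\<in>?F. pmf Q y * g y) = measure_pmf.expectation Q (\<lambda>y. g y * indicator ?F y)"
      using fin by (subst integral_measure_pmf[of ?F]) (auto simp: indicator_def)
    also have "\<dots> \<le> measure_pmf.expectation Q g"
    proof (rule integral_mono)
      show "integrable (measure_pmf Q) (\<lambda>y. g y * indicator ?F y)"
        by (rule measure_pmf.integrable_const_bound[where B = "max m 1"])
          (use m in \<open>auto simp: g_def indicator_def\<close>)
      show "integrable (measure_pmf Q) g"
        by (rule measure_pmf.integrable_const_bound[where B = "max m 1"])
          (use m in \<open>auto simp: g_def\<close>)
    qed (use gpos in \<open>auto simp: indicator_def less_imp_le\<close>)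
    also have "\<dots> = measure_pmf.expectation Q (\<lambda>y. (m - 1) * indicator S y + 1)"
      by (rule Bochner_Integration.integral_cong) (auto simp: g_def indicator_def)
    also have "\<dots> = (m - 1) * measure_pmf.prob Q S + 1"
    proof -
      have "integrable (measure_pmf Q) (\<lambda>y. (m - 1) * indicator S y)"
        by (intro integrable_mult_right measure_pmf.integrable_const_bound[where B = 1]) auto
      then show ?thesis by simp
    qed
    finally show ?thesis .
  qed
  have "measure_pmf.prob P S * ln m - kl P Q * ln 2 - ln 2 =
      (\<Sum>y\<in>?F. pmf P y * (indicator S y * ln m - ln (pmf P y / pmf Q y) - ln 2))"
  proof -
    have "(\<Sum>y\<in>?F. pmf P y * (indicator S y * ln m - ln (pmf P y / pmf Q y) - ln 2)) =
      (\<Sum>y\<in>?F. pmf P y * indicator S y) * ln m -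
      (\<Sum>y\<in>?F. pmf P y * ln (pmf P y / pmf Q y)) - (\<Sum>y\<in>?F. pmf P y) * ln 2"
      unfolding sum_distrib_right sum_subtractf[symmetric]
      by (rule sum.cong) (simp_all add: right_diff_distrib)
    then show ?thesis unfolding PS kl P1 by simp
  qed
  also have "\<dots> \<le> (\<Sum>y\<in>?F. pmf Q y * g y / 2 - pmf P y)"
    by (rule sum_mono) (rule pt)
  also have "\<dots> = (\<Sum>y\<in>?F. pmf Q y * g y) / 2 - 1"
    by (simp add: sum_subtractf P1 sum_divide_distrib)
  also have "\<dots> \<le> ((m - 1) * measure_pmf.prob Q S + 1) / 2 - 1"
    using Qg by simp
  finally show ?thesis
    by (simp add: log_def field_simps)
qed

text \<open>A Fano-type inequality. The decision regions \<open>{y. g y = w}\<close> are disjoint,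
  so their \<open>Q\<close>-probabilities sum to at most 1; the change of measure is applied to each
  region with \<open>m = M\<close> and summed over the messages.\<close>

lemma guessing_bound:
  fixes M :: nat
  assumes M: "0 < M"
    and fin: "\<And>w. w < M \<Longrightarrow> finite (set_pmf (P w))"
    and ac: "\<And>w. w < M \<Longrightarrow> set_pmf (P w) \<subseteq> set_pmf Q"
    and D: "\<And>w. w < M \<Longrightarrow> kl (P w) Q \<le> D"
  shows "measure_pmf.prob (pmf_of_set {0..<M} \<bind> (\<lambda>w. map_pmf (\<lambda>y. (w, g y)) (P w)))
      {(w, v). v = w} * log 2 (real M) \<le> D + 1"
proof -
  let ?q = "\<lambda>w. measure_pmf.prob Q {y. g y = w}"
  have "(\<Sum>w\<in>{0..<M}. ?q w) = measure_pmf.prob Q (\<Union>w\<in>{0..<M}. {y. g y = w})"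
    by (rule measure_pmf.finite_measure_finite_Union[symmetric]) (auto simp: disjoint_family_on_def)
  then have q: "(\<Sum>w\<in>{0..<M}. ?q w) \<le> 1" by simp
  have "(\<Sum>w\<in>{0..<M}. measure_pmf.prob (P w) {y. g y = w} * log 2 (real M)) \<le>
    (\<Sum>w\<in>{0..<M}. D + 1 + (((real M - 1) * ?q w + 1) / 2 - 1) / ln 2)"
  proof (rule sum_mono)
    fix w assume "w \<in> {0..<M}"
    then show "measure_pmf.prob (P w) {y. g y = w} * log 2 (real M) \<le>
        D + 1 + (((real M - 1) * ?q w + 1) / 2 - 1) / ln 2"
      using kl_change_of_measure[OF fin ac, of w "real M" "{y. g y = w}"] M D[of w] by auto
  qed
  also have "\<dots> = M * (D + 1) + (((real M - 1) * (\<Sum>w\<in>{0..<M}. ?q w) + M) / 2 - M) / ln 2"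
    by (simp add: sum.distrib sum_subtractf flip: sum_divide_distrib sum_distrib_left)
  \<comment> \<open>The summed correction is at most \<open>((M - 1) + M) / 2 - M = - 1 / 2\<close>,
    divided by \<open>ln 2\<close>.\<close>
  also have "\<dots> \<le> M * (D + 1)"
  proof -
    have "(real M - 1) * (\<Sum>w\<in>{0..<M}. ?q w) \<le> (real M - 1) * 1"
      using q M by (intro mult_left_mono) auto
    then have "((real M - 1) * (\<Sum>w\<in>{0..<M}. ?q w) + M) / 2 - M \<le> 0"
      by simp
    then have "(((real M - 1) * (\<Sum>w\<in>{0..<M}. ?q w) + M) / 2 - M) / ln 2 \<le> 0"
      by (intro divide_nonpos_pos) auto
    then show ?thesis by simp
  qed
  finally have *: "(\<Sum>w\<in>{0..<M}. measure_pmf.prob (P w) {y. g y = w}) * log 2 (real M)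
      \<le> M * (D + 1)"
    by (simp add: sum_distrib_right)
  have "measure_pmf.prob (pmf_of_set {0..<M} \<bind> (\<lambda>w. map_pmf (\<lambda>y. (w, g y)) (P w)))
      {(w, v). v = w} = (\<Sum>w\<in>{0..<M}. measure_pmf.prob (P w) {y. g y = w}) / M"
    using M by (simp add: prob_bind_pmf integral_pmf_of_set vimage_def)
  moreover have "(\<Sum>w\<in>{0..<M}. measure_pmf.prob (P w) {y. g y = w}) / M * log 2 (real M) \<le> D + 1"
    using * M by (simp add: divide_le_eq mult.commute)
  ultimately show ?thesis by simp
qed

section \<open>Mutual information of symmetric channels with uniform input\<close>

definition output_law :: "(bool \<Rightarrow> 'b pmf) \<Rightarrow> 'b pmf" where
  "output_law c = bernoulli_pmf (1 / 2) \<bind> c"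

text \<open>Both inputs have positive weight, so absolute continuity holds even for noiseless links,
  where the two conditional laws have disjoint supports.\<close>

lemma set_pmf_subset_output_law: "set_pmf (c u) \<subseteq> set_pmf (output_law c)"
  by (auto simp: output_law_def)

lemma simple_distributed_pmf:
  assumes "finite (range Z)"
  shows "simple_distributed (measure_pmf p) Z (pmf (map_pmf Z p))"
  using assms by (intro measure_pmf.simple_distributedI) (auto simp: simple_function_def pmf_map)

lemma mutual_info_eq_sum:
  assumes "finite (range X)" "finite (range Y)"
  shows "mutual_info p X Y = (\<Sum>(x, y)\<in>range X \<times> range Y.
    pmf (map_pmf (\<lambda>\<omega>. (X \<omega>, Y \<omega>)) p) (x, y) *
    log 2 (pmf (map_pmf (\<lambda>\<omega>. (X \<omega>, Y \<omega>)) p) (x, y) / (pmf (map_pmf X p) x * pmf (map_pmf Y p) y)))"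
proof -
  interpret information_space "measure_pmf p" 2
    by unfold_locales simp
  have fXY: "finite (range (\<lambda>\<omega>. (X \<omega>, Y \<omega>)))"
    using assms by (intro finite_subset[OF _ finite_cartesian_product]) auto
  note sd = simple_distributed_pmf[of _ p]
  have "mutual_info p X Y = (\<Sum>(x, y)\<in>range (\<lambda>\<omega>. (X \<omega>, Y \<omega>)).
    pmf (map_pmf (\<lambda>\<omega>. (X \<omega>, Y \<omega>)) p) (x, y) *
    log 2 (pmf (map_pmf (\<lambda>\<omega>. (X \<omega>, Y \<omega>)) p) (x, y) / (pmf (map_pmf X p) x * pmf (map_pmf Y p) y)))"
    using mutual_information_simple_distributed[OF sd[OF assms(1)] sd[OF assms(2)] sd[OF fXY]]
    by (simp add: mutual_info_def)
  also have "\<dots> = (\<Sum>(x, y)\<in>range X \<times> range Y.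
    pmf (map_pmf (\<lambda>\<omega>. (X \<omega>, Y \<omega>)) p) (x, y) *
    log 2 (pmf (map_pmf (\<lambda>\<omega>. (X \<omega>, Y \<omega>)) p) (x, y) / (pmf (map_pmf X p) x * pmf (map_pmf Y p) y)))"
  \<comment> \<open>Pairs outside the joint range have mass 0; including them makes the index set a
    rectangle, so that the sum can be iterated.\<close>
  proof (rule sum.mono_neutral_left)
    show "finite (range X \<times> range Y)" using assms by simp
    show "\<forall>i\<in>range X \<times> range Y - range (\<lambda>\<omega>. (X \<omega>, Y \<omega>)).
      (case i of (x, y) \<Rightarrow> pmf (map_pmf (\<lambda>\<omega>. (X \<omega>, Y \<omega>)) p) (x, y) *
        log 2 (pmf (map_pmf (\<lambda>\<omega>. (X \<omega>, Y \<omega>)) p) (x, y) /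
          (pmf (map_pmf X p) x * pmf (map_pmf Y p) y))) = 0"
    proof
      fix i assume "i \<in> range X \<times> range Y - range (\<lambda>\<omega>. (X \<omega>, Y \<omega>))"
      then have "i \<notin> set_pmf (map_pmf (\<lambda>\<omega>. (X \<omega>, Y \<omega>)) p)" by auto
      then show "(case i of (x, y) \<Rightarrow> pmf (map_pmf (\<lambda>\<omega>. (X \<omega>, Y \<omega>)) p) (x, y) *
        log 2 (pmf (map_pmf (\<lambda>\<omega>. (X \<omega>, Y \<omega>)) p) (x, y) /
          (pmf (map_pmf X p) x * pmf (map_pmf Y p) y))) = 0"
        by (cases i) (simp add: set_pmf_iff del: set_map_pmf)
    qed
  qed auto
  finally show ?thesis .
qed

text \<open>The relabelling \<open>\<sigma>\<close> exchanges the two conditional laws, hence fixes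
  their uniform mixture, and an injective relabelling preserves relative entropy.\<close>

lemma kl_output_law_symmetric:
  assumes \<sigma>: "inj \<sigma>" and c: "\<And>u. map_pmf \<sigma> (c u) = c (\<not> u)"
  shows "kl (c u) (output_law c) = kl (c v) (output_law c)"
proof -
  have "map_pmf Not (bernoulli_pmf (1 / 2)) = bernoulli_pmf (1 / 2)"
    unfolding bernoulli_pmf_half_conv_pmf_of_set
    by (subst map_pmf_of_set_inj) (auto simp: inj_on_def UNIV_bool insert_commute)
  then have "map_pmf \<sigma> (output_law c) = output_law c"
    unfolding output_law_def map_bind_pmf c by (metis bind_map_pmf)
  then have "kl (c True) (output_law c) = kl (c False) (output_law c)"
    using kl_map_pmf_inj[OF \<sigma>, of "c True" "output_law c"] c[of True] by simp
  then show ?thesis by (cases u; cases v) auto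
qed

text \<open>Mutual information is the input average of the divergences of the conditional laws from
  the output law; by symmetry these coincide, so any single \<open>u\<close> gives the
  value.\<close>

lemma mutual_info_uniform_input:
  assumes fin: "finite (range Y)"
    and joint: "map_pmf (\<lambda>\<omega>. (X \<omega>, Y \<omega>)) p = bernoulli_pmf (1 / 2) \<bind> (\<lambda>u. map_pmf (Pair u) (c u))"
    and \<sigma>: "inj \<sigma>" and c: "\<And>u. map_pmf \<sigma> (c u) = c (\<not> u)"
  shows "mutual_info p X Y = kl (c u) (output_law c)"
proof -
  let ?J = "map_pmf (\<lambda>\<omega>. (X \<omega>, Y \<omega>)) p"
  have "map_pmf X p = map_pmf fst ?J" by (simp add: map_pmf_comp)
  also have "\<dots> = bernoulli_pmf (1 / 2)"
    unfolding joint by (simp add: map_bind_pmf map_pmf_comp bind_return_pmf')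
  finally have X: "map_pmf X p = bernoulli_pmf (1 / 2)" .
  have "map_pmf Y p = map_pmf snd ?J" by (simp add: map_pmf_comp)
  also have "\<dots> = output_law c"
    unfolding joint output_law_def by (simp add: map_bind_pmf map_pmf_comp)
  finally have Y: "map_pmf Y p = output_law c" .
  have "range X = UNIV"
  proof -
    have "set_pmf (map_pmf X p) \<subseteq> range X" by auto
    then show ?thesis unfolding X by auto
  qed
  have supp: "set_pmf (c v) \<subseteq> range Y" for v
  proof -
    have "set_pmf (map_pmf Y p) \<subseteq> range Y" by auto
    then show ?thesis unfolding Y using set_pmf_subset_output_law[of c v] by blast
  qed
  \<comment> \<open>This factor 1/2 cancels against the marginal of \<open>X\<close> inside the
    logarithm.\<close>
  have J: "pmf ?J (v, y) = pmf (c v) y / 2" for v y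
  proof -
    have "pmf (map_pmf (Pair v') (c v')) (v, y) = (if v' = v then pmf (c v) y else 0)" for v'
    proof (cases "v' = v")
      case True
      then show ?thesis using pmf_map_inj'[of "Pair v" "c v" y] by (simp add: inj_def)
    next
      case False
      then show ?thesis by (auto simp: pmf_map measure_pmf_zero_iff)
    qed
    then show ?thesis unfolding joint pmf_bind by (cases v) simp_all
  qed
  have "mutual_info p X Y = (\<Sum>v\<in>UNIV. \<Sum>y\<in>range Y. pmf (c v) y / 2 *
      log 2 (pmf (c v) y / pmf (output_law c) y))"
    using fin by (subst mutual_info_eq_sum)
      (simp_all only: \<open>range X = UNIV\<close> X Y J sum.cartesian_product[symmetric], simp_all add: UNIV_bool)
  also have "\<dots> = (\<Sum>v\<in>UNIV. kl (c v) (output_law c) / 2)"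
    using fin supp by (simp add: kl_eq_sum[of "range Y"] sum_divide_distrib)
  also have "\<dots> = kl (c u) (output_law c)"
    using kl_output_law_symmetric[of \<sigma> c, OF \<sigma> c, of True u]
      kl_output_law_symmetric[of \<sigma> c, OF \<sigma> c, of False u]
    by (simp add: UNIV_bool)
  finally show ?thesis .
qed

section \<open>The two hops as symmetric channels\<close>

definition bit_channel :: "real \<Rightarrow> bool \<Rightarrow> bool pmf" where
  "bit_channel p u = map_pmf (\<lambda>e. u \<noteq> e) (bernoulli_pmf p)"

text \<open>One use of the whole first hop, seen as a single channel with a list as output; relay
  \<open>i\<close> owns entry \<open>i - 1\<close>.\<close>

definition broadcast_channel :: "nat \<Rightarrow> (nat \<Rightarrow> real) \<Rightarrow> bool \<Rightarrow> bool list pmf" where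
  "broadcast_channel K ps u =
    map_pmf (\<lambda>z. map (\<lambda>i. u \<noteq> z i) [1..<Suc K]) (Pi_pmf {1..K} False (\<lambda>i. bernoulli_pmf (ps i)))"

lemma bit_channel_flip: "map_pmf Not (bit_channel p u) = bit_channel p (\<not> u)"
  unfolding bit_channel_def map_pmf_comp by (rule map_pmf_cong) auto

lemma broadcast_channel_flip:
  "map_pmf (map Not) (broadcast_channel K ps u) = broadcast_channel K ps (\<not> u)"
  unfolding broadcast_channel_def map_pmf_comp by (rule map_pmf_cong) auto

lemma inj_Not: "inj Not" by (simp add: inj_def)

abbreviation uniform_single_letter where
  "uniform_single_letter K ps pd \<equiv>
    single_letter K ps pd (bernoulli_pmf (1 / 2)) (\<lambda>_. bernoulli_pmf (1 / 2))"

text \<open>Identifies the first term of the minimum with the divergence appearing in the source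
  cut; \<open>v\<close> is arbitrary because flipping the input flips all outputs.\<close>

lemma mutual_info_broadcast:
  "mutual_info (uniform_single_letter K ps pd) (\<lambda>(u, x, z, e). u)
     (\<lambda>(u, x, z, e). map (\<lambda>i. u \<noteq> z i) [1..<Suc K]) =
   kl (broadcast_channel K ps v) (output_law (broadcast_channel K ps))"
proof (rule mutual_info_uniform_input)
  show "finite (range (\<lambda>(u, x, z, e). map (\<lambda>i. u \<noteq> z i) [1..<Suc K]))"
    by (rule finite_subset[OF _ finite_lists_length_eq[of UNIV K]]) auto
  show "map_pmf (\<lambda>\<omega>. (case \<omega> of (u, x, z, e) \<Rightarrow> u, case \<omega> of (u, x, z, e) \<Rightarrow>
      map (\<lambda>i. u \<noteq> z i) [1..<Suc K])) (uniform_single_letter K ps pd) =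
    bernoulli_pmf (1 / 2) \<bind> (\<lambda>u. map_pmf (Pair u) (broadcast_channel K ps u))"
    unfolding single_letter_def pair_pmf_def broadcast_channel_def
    by (simp add: map_bind_pmf bind_assoc_pmf bind_return_pmf map_pmf_comp)
       (simp add: map_pmf_def)
  show "inj (map Not)" using inj_Not by (simp add: inj_mapI)
qed (rule broadcast_channel_flip)

lemma mutual_info_link:
  assumes i: "i \<in> {1..K}"
  shows "mutual_info (uniform_single_letter K ps pd) (\<lambda>(u, x, z, e). x i)
     (\<lambda>(u, x, z, e). x i \<noteq> e i) =
   kl (bit_channel (pd i) v) (output_law (bit_channel (pd i)))"
proof (rule mutual_info_uniform_input)
  have "map_pmf (\<lambda>\<omega>. (case \<omega> of (u, x, z, e) \<Rightarrow> x i, case \<omega> of (u, x, z, e) \<Rightarrow>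
      x i \<noteq> e i)) (uniform_single_letter K ps pd) =
    map_pmf (\<lambda>x. x i) (Pi_pmf {1..K} False (\<lambda>_. bernoulli_pmf (1 / 2))) \<bind>
      (\<lambda>a. map_pmf (\<lambda>b. (a, a \<noteq> b))
        (map_pmf (\<lambda>e. e i) (Pi_pmf {1..K} False (\<lambda>i. bernoulli_pmf (pd i)))))"
    unfolding single_letter_def pair_pmf_def
    by (simp add: map_bind_pmf bind_assoc_pmf bind_return_pmf map_pmf_comp bind_map_pmf)
       (simp add: map_pmf_def)
  also have "\<dots> = bernoulli_pmf (1 / 2) \<bind> (\<lambda>u. map_pmf (Pair u) (bit_channel (pd i) u))"
    using i by (simp add: Pi_pmf_component bit_channel_def map_pmf_comp)
  finally show "map_pmf (\<lambda>\<omega>. (case \<omega> of (u, x, z, e) \<Rightarrow> x i, case \<omega> of (u, x, z, e) \<Rightarrow>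
      x i \<noteq> e i)) (uniform_single_letter K ps pd) =
    bernoulli_pmf (1 / 2) \<bind> (\<lambda>u. map_pmf (Pair u) (bit_channel (pd i) u))" .
qed (auto intro: inj_Not bit_channel_flip)

section \<open>Cut bounds on the success probability\<close>

definition success_prob ::
  "nat \<Rightarrow> (nat \<Rightarrow> real) \<Rightarrow> (nat \<Rightarrow> real) \<Rightarrow> real \<Rightarrow> nat \<Rightarrow> bspr_code \<Rightarrow> real" where
  "success_prob K ps pd R n c = 1 - error_prob K ps pd R n c"

lemma num_messages_pos: "0 < num_messages n R"
  by (simp add: num_messages_def)

text \<open>Passing to the pair of message and estimate gives the event the shape used in
  \<open>guessing_bound\<close>.\<close>

lemma success_prob_eq:
  "success_prob K ps pd R n c = measure_pmf.prob
     (map_pmf (\<lambda>(w, z, e). (w, decoded K n c w z e))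
       (pair_pmf (pmf_of_set {0..<num_messages n R})
         (pair_pmf (block_noise K n ps) (block_noise K n pd))))
     {(w, v). v = w}"
proof -
  have "{(w, z, e). decoded K n c w z e \<noteq> w} = - {(w, z, e). decoded K n c w z e = w}"
    by auto
  then show ?thesis
    unfolding success_prob_def error_prob_def
    by (simp add: Compl_eq_Diff_UNIV measure_pmf.prob_compl[simplified]
        vimage_def case_prod_unfold)
qed

text \<open>By independence the draws commute, so the second-hop noise can be drawn first and held
  fixed.\<close>

lemma success_prob_source:
  "success_prob K ps pd R n c = measure_pmf.prob
     (block_noise K n pd \<bind> (\<lambda>e. pmf_of_set {0..<num_messages n R} \<bind>
       (\<lambda>w. map_pmf (\<lambda>z. (w, decoded K n c w z e)) (block_noise K n ps)))) {(w, v). v = w}"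
proof -
  let ?W = "pmf_of_set {0..<num_messages n R}" and ?f = "\<lambda>w z e. (w, decoded K n c w z e)"
  have "map_pmf (\<lambda>(w, z, e). ?f w z e) (pair_pmf ?W (pair_pmf (block_noise K n ps) (block_noise K n pd))) =
    ?W \<bind> (\<lambda>w. block_noise K n ps \<bind> (\<lambda>z. block_noise K n pd \<bind> (\<lambda>e. return_pmf (?f w z e))))"
    by (simp add: pair_pmf_def map_bind_pmf bind_assoc_pmf bind_return_pmf)
  also have "\<dots> = ?W \<bind> (\<lambda>w. block_noise K n pd \<bind> (\<lambda>e. block_noise K n ps \<bind> (\<lambda>z. return_pmf (?f w z e))))"
    by (subst bind_commute_pmf[of "block_noise K n ps"]) simp
  also have "\<dots> = block_noise K n pd \<bind> (\<lambda>e. ?W \<bind> (\<lambda>w. block_noise K n ps \<bind> (\<lambda>z. return_pmf (?f w z e))))"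
    by (rule bind_commute_pmf)
  finally show ?thesis
    unfolding success_prob_eq by (simp add: map_pmf_def)
qed

lemma success_prob_destination:
  "success_prob K ps pd R n c = measure_pmf.prob
     (block_noise K n ps \<bind> (\<lambda>z. pmf_of_set {0..<num_messages n R} \<bind>
       (\<lambda>w. map_pmf (\<lambda>e. (w, decoded K n c w z e)) (block_noise K n pd)))) {(w, v). v = w}"
proof -
  let ?W = "pmf_of_set {0..<num_messages n R}" and ?f = "\<lambda>w z e. (w, decoded K n c w z e)"
  have "map_pmf (\<lambda>(w, z, e). ?f w z e) (pair_pmf ?W (pair_pmf (block_noise K n ps) (block_noise K n pd))) =
    ?W \<bind> (\<lambda>w. block_noise K n ps \<bind> (\<lambda>z. block_noise K n pd \<bind> (\<lambda>e. return_pmf (?f w z e))))"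
    by (simp add: pair_pmf_def map_bind_pmf bind_assoc_pmf bind_return_pmf)
  also have "\<dots> = block_noise K n ps \<bind> (\<lambda>z. ?W \<bind> (\<lambda>w. block_noise K n pd \<bind> (\<lambda>e. return_pmf (?f w z e))))"
    by (rule bind_commute_pmf)
  finally show ?thesis
    unfolding success_prob_eq by (simp add: map_pmf_def)
qed


text \<open>
  Source cut: with the second-hop noise \<open>e\<close> fixed, relays and decoder together are one deterministic
  map \<open>g\<close> of the words received by the relays. Destination cut: with the first-hop noise \<open>z\<close> fixed,
  the relay inputs are a deterministic function of the message.
\<close>

lemma
  shows source_cut_bound:
      "success_prob K ps pd R n c * log 2 (num_messages n R) \<le>
        n * kl (broadcast_channel K ps v) (output_law (broadcast_channel K ps)) + 1"
    and destination_cut_bound: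
      "success_prob K ps pd R n c * log 2 (num_messages n R) \<le>
        n * (\<Sum>i = 1..K. kl (bit_channel (pd i) v) (output_law (bit_channel (pd i)))) + 1"
proof -
  show "success_prob K ps pd R n c * log 2 (num_messages n R) \<le>
    n * kl (broadcast_channel K ps v) (output_law (broadcast_channel K ps)) + 1"
    unfolding success_prob_source
  proof (rule prob_bind_pmf_mult_le)
    fix e
    let ?C = "broadcast_channel K ps"
    define P where "P w = Pi_pmf {1..n} [] (\<lambda>t. ?C (source_enc c w t))" for w
    \<comment> \<open>The index \<open>i - 1\<close> converts relay numbers, which start at 1, to
      list positions, which start at 0.\<close>
    define g where "g V = decoder c (map (\<lambda>i. map (\<lambda>t.
        relay_enc c i t (map (\<lambda>s. V s ! (i - 1)) [1..<t]) \<noteq> e (i, t)) [1..<Suc n]) [1..<Suc K])"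
      for V :: "nat \<Rightarrow> bool list"
    \<comment> \<open>Grouped by time, the first-hop noise consists of independent vectors, one for
      each use of the broadcast channel.\<close>
    have P: "P w = map_pmf (\<lambda>z t. if t \<in> {1..n} then map (\<lambda>i. source_enc c w t \<noteq> z (i, t)) [1..<Suc K] else [])
        (block_noise K n ps)" for w
      unfolding P_def block_noise_def broadcast_channel_def
      by (subst Pi_pmf_map_dependent[where d = "\<lambda>_. False"], simp)
        (unfold Pi_pmf_Times[OF finite_atLeastAtMost finite_atLeastAtMost] map_pmf_comp prod.case, rule refl)
    have dec: "decoded K n c w z e =
        g (\<lambda>t. if t \<in> {1..n} then map (\<lambda>i. source_enc c w t \<noteq> z (i, t)) [1..<Suc K] else [])" for w z
      unfolding decoded_def g_def
    proof (intro arg_cong[where f = "decoder c"] map_cong refl)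
      \<comment> \<open>Causality: since \<open>t \<le> n\<close>, the relay reads only times
        \<open>s < t\<close> inside \<open>{1..n}\<close>, where the default \<open>[]\<close> never
        occurs.\<close>
      fix i t assume "i \<in> set [1..<Suc K]" "t \<in> set [1..<Suc n]"
      then have "map (relay_received c w z i) [1..<t] = map (\<lambda>s. (if s \<in> {1..n}
          then map (\<lambda>i. source_enc c w s \<noteq> z (i, s)) [1..<Suc K] else []) ! (i - 1)) [1..<t]"
        by (auto simp: relay_received_def simp del: upt_Suc)
      then show "dest_received c w z e i t = (relay_enc c i t (map (\<lambda>s. (if s \<in> {1..n}
          then map (\<lambda>i. source_enc c w s \<noteq> z (i, s)) [1..<Suc K] else []) ! (i - 1)) [1..<t]) \<noteq> e (i, t))"
        by (simp only: dest_received_def relay_sent_def)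
    qed
    have "map_pmf (\<lambda>z. (w, decoded K n c w z e)) (block_noise K n ps) = map_pmf (\<lambda>V. (w, g V)) (P w)" for w
      unfolding P dec map_pmf_comp ..
    moreover have "measure_pmf.prob (pmf_of_set {0..<num_messages n R} \<bind>
        (\<lambda>w. map_pmf (\<lambda>V. (w, g V)) (P w))) {(w, v). v = w} * log 2 (num_messages n R)
      \<le> n * kl (?C v) (output_law ?C) + 1"
    proof (rule guessing_bound[where Q = "Pi_pmf {1..n} [] (\<lambda>_. output_law ?C)"])
      have fin: "finite (set_pmf (?C u))" for u
        by (rule finite_subset[OF _ finite_lists_length_eq[of UNIV K]]) (auto simp: broadcast_channel_def)
      show "finite (set_pmf (P w))" for w
        unfolding P_def using fin by (simp add: set_Pi_pmf finite_PiE_dflt)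
      show "set_pmf (P w) \<subseteq> set_pmf (Pi_pmf {1..n} [] (\<lambda>_. output_law ?C))" for w
        unfolding P_def using set_pmf_subset_output_law[of ?C]
        by (force simp: set_Pi_pmf PiE_dflt_def)
      show "kl (P w) (Pi_pmf {1..n} [] (\<lambda>_. output_law ?C)) \<le> n * kl (?C v) (output_law ?C)" for w
      proof -
        have "kl (P w) (Pi_pmf {1..n} [] (\<lambda>_. output_law ?C)) =
            (\<Sum>t = 1..n. kl (?C (source_enc c w t)) (output_law ?C))"
          unfolding P_def by (rule kl_Pi_pmf) (simp_all add: fin set_pmf_subset_output_law)
        \<comment> \<open>By symmetry the transmitted symbol does not affect the divergence, so the
          codeword disappears from the bound.\<close>
        also have "\<dots> = (\<Sum>t = 1..n. kl (?C v) (output_law ?C))"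
          by (intro sum.cong refl kl_output_law_symmetric[of "map Not"])
            (simp_all add: inj_Not broadcast_channel_flip)
        finally show ?thesis by simp
      qed
    qed (rule num_messages_pos)
    ultimately show "measure_pmf.prob (pmf_of_set {0..<num_messages n R} \<bind>
        (\<lambda>w. map_pmf (\<lambda>z. (w, decoded K n c w z e)) (block_noise K n ps))) {(w, v). v = w} *
          log 2 (num_messages n R)
      \<le> n * kl (?C v) (output_law ?C) + 1"
      by simp
  qed
  show "success_prob K ps pd R n c * log 2 (num_messages n R) \<le>
    n * (\<Sum>i = 1..K. kl (bit_channel (pd i) v) (output_law (bit_channel (pd i)))) + 1"
    unfolding success_prob_destination
  proof (rule prob_bind_pmf_mult_le)
    fix z
    let ?A = "{1..K} \<times> {1..n}"
    let ?C = "\<lambda>i. bit_channel (pd i)"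
    define Q where "Q = Pi_pmf ?A False (\<lambda>(i, t). output_law (?C i))"
    \<comment> \<open>With \<open>z\<close> fixed the symbol sent by each relay is determined by
      \<open>w\<close>, so the received bits are independent over relays and times.\<close>
    define P where "P w = Pi_pmf ?A False (\<lambda>(i, t). ?C i (relay_sent c w z i t))" for w
    define g where "g Y = decoder c (map (\<lambda>i. map (\<lambda>t. Y (i, t)) [1..<Suc n]) [1..<Suc K])"
      for Y :: "nat \<times> nat \<Rightarrow> bool"
    have P: "P w = map_pmf (\<lambda>e x. if x \<in> ?A then relay_sent c w z (fst x) (snd x) \<noteq> e x else False)
        (block_noise K n pd)" for w
      unfolding P_def block_noise_def bit_channel_def case_prod_unfold
      by (rule Pi_pmf_map_dependent) simp
    have dec: "decoded K n c w z e =
        g (\<lambda>x. if x \<in> ?A then relay_sent c w z (fst x) (snd x) \<noteq> e x else False)" for w e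
      unfolding decoded_def g_def
      by (intro arg_cong[where f = "decoder c"] map_cong refl) (auto simp: dest_received_def)
    have "map_pmf (\<lambda>e. (w, decoded K n c w z e)) (block_noise K n pd) = map_pmf (\<lambda>Y. (w, g Y)) (P w)" for w
      unfolding P dec map_pmf_comp ..
    moreover have "measure_pmf.prob (pmf_of_set {0..<num_messages n R} \<bind>
        (\<lambda>w. map_pmf (\<lambda>Y. (w, g Y)) (P w))) {(w, v). v = w} * log 2 (num_messages n R)
      \<le> n * (\<Sum>i = 1..K. kl (?C i v) (output_law (?C i))) + 1"
    proof (rule guessing_bound[where Q = Q])
      show "finite (set_pmf (P w))" for w
        unfolding P_def by (auto simp: set_Pi_pmf)
      show "set_pmf (P w) \<subseteq> set_pmf Q" for w
        unfolding P_def Q_def using set_pmf_subset_output_law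
        by (fastforce simp: set_Pi_pmf PiE_dflt_def)
      show "kl (P w) Q \<le> n * (\<Sum>i = 1..K. kl (?C i v) (output_law (?C i)))" for w
      proof -
        have "kl (P w) Q = (\<Sum>(i, t)\<in>?A. kl (?C i (relay_sent c w z i t)) (output_law (?C i)))"
          unfolding P_def Q_def
          by (subst kl_Pi_pmf) (auto simp: case_prod_unfold dest: set_mp[OF set_pmf_subset_output_law])
        also have "\<dots> = (\<Sum>i = 1..K. \<Sum>t = 1..n. kl (?C i (relay_sent c w z i t)) (output_law (?C i)))"
          by (rule sum.cartesian_product[symmetric])
        also have "\<dots> = (\<Sum>i = 1..K. \<Sum>t = 1..n. kl (?C i v) (output_law (?C i)))"
          by (intro sum.cong refl kl_output_law_symmetric[of Not])
            (simp_all add: inj_Not bit_channel_flip)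
        finally show ?thesis by (simp add: sum_distrib_left)
      qed
    qed (rule num_messages_pos)
    ultimately show "measure_pmf.prob (pmf_of_set {0..<num_messages n R} \<bind>
        (\<lambda>w. map_pmf (\<lambda>e. (w, decoded K n c w z e)) (block_noise K n pd))) {(w, v). v = w} *
          log 2 (num_messages n R)
      \<le> n * (\<Sum>i = 1..K. kl (?C i v) (output_law (?C i))) + 1"
      by simp
  qed
qed

section \<open>From block bounds to rates\<close>

lemma log_num_messages_ge: "real n * R \<le> log 2 (num_messages n R)"
proof -
  have "2 powr (real n * R) \<le> num_messages n R"
    unfolding num_messages_def by linarith
  then show ?thesis
    using num_messages_pos[of n R] by (simp add: le_log_iff)
qed

text \<open>At success probability near 1 the block bound divided by \<open>n\<close> reads
  \<open>R \<le> C\<close> up to a vanishing error; one sufficiently long code for each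
  \<open>\<delta>\<close> is enough.\<close>

lemma achievable_le:
  fixes C :: real
  assumes ach: "achievable K ps pd R"
    and bound: "\<And>n c. success_prob K ps pd R n c * log 2 (num_messages n R) \<le> n * C + 1"
  shows "R \<le> C"
proof (rule field_le_epsilon)
  fix \<delta> :: real assume \<delta>: "\<delta> > 0"
  have R: "R \<ge> 0" using ach by (simp add: achievable_def)
  \<comment> \<open>Half of \<open>\<delta>\<close> pays for the loss \<open>\<epsilon> * R\<close>;
    the summand 1 keeps the denominator positive when \<open>R = 0\<close>.\<close>
  define \<epsilon> where "\<epsilon> = \<delta> / (2 * (R + 1))"
  have \<epsilon>: "\<epsilon> > 0" "\<epsilon> * R \<le> \<delta> / 2"
    using \<delta> R by (simp_all add: \<epsilon>_def field_simps)
  obtain N where N: "\<And>n. n \<ge> N \<Longrightarrow> \<exists>c. error_prob K ps pd R n c < \<epsilon>"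
    using ach \<epsilon>(1) unfolding achievable_def by blast
  \<comment> \<open>The other half of \<open>\<delta>\<close> pays for the additive 1, since
    \<open>n > 2 / \<delta>\<close> gives \<open>1 \<le> n * (\<delta> / 2)\<close>.\<close>
  obtain n0 :: nat where n0: "2 / \<delta> < real n0" using reals_Archimedean2 by blast
  define n where "n = max N n0"
  obtain c where c: "error_prob K ps pd R n c < \<epsilon>" using N[of n] by (auto simp: n_def)
  have n: "2 / \<delta> < n" using n0 by (simp add: n_def)
  moreover have "2 / \<delta> > 0" using \<delta> by simp
  ultimately have n_pos: "real n > 0" by linarith
  have s: "0 \<le> success_prob K ps pd R n c"
    unfolding success_prob_def error_prob_def by simp
  have "(1 - \<epsilon>) * (n * R) \<le> success_prob K ps pd R n c * (n * R)"
    using c R by (intro mult_right_mono) (simp_all add: success_prob_def)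
  also have "\<dots> \<le> success_prob K ps pd R n c * log 2 (num_messages n R)"
    using s log_num_messages_ge by (intro mult_left_mono)
  also have "\<dots> \<le> n * C + 1" by (rule bound)
  also have "1 \<le> n * (\<delta> / 2)" using n \<delta> by (simp add: field_simps)
  finally have "n * ((1 - \<epsilon>) * R) \<le> n * (C + \<delta> / 2)" by (simp add: algebra_simps)
  then have "(1 - \<epsilon>) * R \<le> C + \<delta> / 2" using n_pos by simp
  then show "R \<le> C + \<delta>" using \<epsilon>(2) by (simp add: algebra_simps)
qed

theorem theorem2:
  fixes K :: nat and ps pd :: "nat \<Rightarrow> real" and R :: real
  assumes "K \<ge> 1"
    and "\<And>i. i \<in> {1..K} \<Longrightarrow> 0 \<le> ps i \<and> ps i \<le> 1 / 2"
    and "\<And>i. i \<in> {1..K} \<Longrightarrow> 0 \<le> pd i \<and> pd i \<le> 1 / 2"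
    and "achievable K ps pd R"
  shows "\<exists>(pu :: bool pmf) (px :: nat \<Rightarrow> bool pmf).
    R \<le> min
      (mutual_info (single_letter K ps pd pu px)
        (\<lambda>(u, x, z, e). u)
        (\<lambda>(u, x, z, e). map (\<lambda>i. u \<noteq> z i) [1..<Suc K]))
      (\<Sum>i = 1..K. mutual_info (single_letter K ps pd pu px)
        (\<lambda>(u, x, z, e). x i)
        (\<lambda>(u, x, z, e). x i \<noteq> e i))"
proof (intro exI)
  have "R \<le> kl (broadcast_channel K ps False) (output_law (broadcast_channel K ps))"
    using assms(4) source_cut_bound by (rule achievable_le)
  moreover have "R \<le> (\<Sum>i = 1..K. kl (bit_channel (pd i) False) (output_law (bit_channel (pd i))))"
    using assms(4) destination_cut_bound by (rule achievable_le)
  \<comment> \<open>The witnesses are the uniform laws for \<open>U\<close> and all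
    \<open>X_i\<close>; the reference input \<open>False\<close> is one admissible choice of
    \<open>v\<close>.\<close>
  ultimately show "R \<le> min
      (mutual_info (uniform_single_letter K ps pd)
        (\<lambda>(u, x, z, e). u)
        (\<lambda>(u, x, z, e). map (\<lambda>i. u \<noteq> z i) [1..<Suc K]))
      (\<Sum>i = 1..K. mutual_info (uniform_single_letter K ps pd)
        (\<lambda>(u, x, z, e). x i)
        (\<lambda>(u, x, z, e). x i \<noteq> e i))"
    by (simp only: mutual_info_broadcast[where v = False] mutual_info_link[where v = False]
        min.bounded_iff cong: sum.cong)
qed

end
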